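(* Let $0<q<1$ be fixed. The functions $$x\mapsto-\psi_q(x)+\ln\left(\frac{1-q^x}{1-q}\right)+\frac{(\ln q)q^x}{2(1-q^x)}+\frac1{12}\psi_q''(x+1/2)$$ and $$x\mapsto\psi_q(x)-\ln\left(\frac{1-q^x}{1-q}\right)-\frac{(\ln q)q^x}{2(1-q^x)}-\frac1{12}\psi_q''(x)$$ are completely monotonic on $(0,+\infty)$.
   Context: For $0<q<1$ and $x>0$, the $q$-gamma function is $$\Gamma_q(x)=\frac{(q;q)_\infty}{(q^x;q)_\infty}(1-q)^{1-x},\qquad (a;q)_\infty=\prod_{n=0}^\infty(1-aq^n),$$ and $\psi_q=\Gamma_q'/\Gamma_q$ is its logarithmic derivative on $(0,+\infty)$. A function $f$ is completely monotonic on $(a,b)$ if it has derivatives of all orders there and $(-1)^kf^{(k)}(x)\geq0$ for all $x\in(a,b)$ and all integers $k\geq0$. *)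

theory Defs
  imports "HOL-Analysis.Analysis"
begin

definition qpochhammer_inf :: "real \<Rightarrow> real \<Rightarrow> real" where
  "qpochhammer_inf a q = (\<Prod>n. 1 - a * q ^ n)"

definition q_Gamma :: "real \<Rightarrow> real \<Rightarrow> real" where
  "q_Gamma q x = qpochhammer_inf q q / qpochhammer_inf (q powr x) q * (1 - q) powr (1 - x)"

definition q_Digamma :: "real \<Rightarrow> real \<Rightarrow> real" where
  "q_Digamma q x = deriv (q_Gamma q) x / q_Gamma q x"

text \<open>
  Intended for open \<open>S\<close>: derivatives are two-sided.  Since \<^const>\<open>deriv\<close> returns an
  unspecified value where no derivative exists, existence of every derivative is demanded
  explicitly.
\<close>
definition completely_monotonic_on :: "real set \<Rightarrow> (real \<Rightarrow> real) \<Rightarrow> bool" where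
  "completely_monotonic_on S f \<longleftrightarrow>
     (\<forall>k. \<forall>x\<in>S. (deriv ^^ k) f field_differentiable (at x)) \<and>
     (\<forall>k. \<forall>x\<in>S. (-1) ^ k * (deriv ^^ k) f x \<ge> 0)"

end

theory Submission
  imports Defs
begin

text \<open>
  With \<open>z = q\<^sup>x\<close> everything in sight is a power series in \<open>z\<close>, convergent for \<open>\<bar>z\<bar> < 1\<close>, and
  such a series is completely monotonic in \<open>x\<close> as soon as its coefficients are nonnegative.
  The expansion \<open>(z; q)\<^sub>\<infinity> = exp (- (\<Sum>k\<ge>1. z\<^sup>k / (k (1 - q\<^sup>k))))\<close> follows by iterating the
  functional equation \<open>g z = (1 - z) g (q z)\<close> of the right-hand side.  For \<open>u = - k ln q / 2\<close>, the
  coefficients of \<open>z\<^sup>k\<close> in the two functions are nonnegative iff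
  \<open>u\<^sup>3 / 3 \<le> u cosh u - sinh u \<le> e\<^sup>u u\<^sup>3 / 3\<close>.
\<close>

section \<open>Power series on the open unit disc\<close>

text \<open>Radius of convergence at least 1: for \<open>x > 0\<close> the point
  \<open>q powr x\<close> lies in (0, 1), and the class is closed under every operation on
  coefficients used below.\<close>

definition unit_disc_summable :: "(nat \<Rightarrow> real) \<Rightarrow> bool" where
  "unit_disc_summable c \<longleftrightarrow> (\<forall>z. \<bar>z\<bar> < 1 \<longrightarrow> summable (\<lambda>n. c n * z ^ n))"

definition q_series :: "real \<Rightarrow> (nat \<Rightarrow> real) \<Rightarrow> real \<Rightarrow> real" where
  "q_series q c x = (\<Sum>n. c n * (q powr x) ^ n)"

lemma q_powr_bounds:
  fixes q x :: real
  assumes "0 < q" "q < 1" "x > 0"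
  shows "0 < q powr x" "q powr x < 1" "\<bar>q powr x\<bar> < 1"
proof -
  show "0 < q powr x" using assms by simp
  have "x * ln q < 0" using assms by (simp add: mult_pos_neg)
  then show "q powr x < 1" using assms by (simp add: powr_def)
  then show "\<bar>q powr x\<bar> < 1" using \<open>0 < q powr x\<close> by simp
qed

lemma unit_disc_summable_bounded:
  assumes "\<And>n. \<bar>c n\<bar> \<le> B"
  shows "unit_disc_summable c"
  unfolding unit_disc_summable_def
proof safe
  fix z :: real assume z: "\<bar>z\<bar> < 1"
  have "summable (\<lambda>n. B * \<bar>z\<bar> ^ n)"
    using z by (intro summable_mult summable_geometric) simp
  then show "summable (\<lambda>n. c n * z ^ n)"
    by (rule summable_comparison_test'[where N = 0])
       (use assms in \<open>auto simp: abs_mult power_abs intro!: mult_right_mono\<close>)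
qed

lemma unit_disc_summable_inverse_nat: "unit_disc_summable (\<lambda>n. 1 / real n)"
  by (rule unit_disc_summable_bounded[where B = 1]) (auto simp: divide_simps)

lemma unit_disc_summable_const: "unit_disc_summable (\<lambda>n. if n = 0 then a else 0)"
  by (rule unit_disc_summable_bounded[where B = "\<bar>a\<bar>"]) auto

lemma unit_disc_summable_add:
  "unit_disc_summable c \<Longrightarrow> unit_disc_summable d \<Longrightarrow> unit_disc_summable (\<lambda>n. c n + d n)"
  unfolding unit_disc_summable_def by (auto simp: distrib_right intro!: summable_add)

lemma unit_disc_summable_cmult:
  "unit_disc_summable c \<Longrightarrow> unit_disc_summable (\<lambda>n. a * c n)"
  unfolding unit_disc_summable_def by (auto simp: mult.assoc intro!: summable_mult)

text \<open>The factor \<open>a ^ n\<close> is absorbed into \<open>z\<close>. It arises from the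
  shift of \<open>x\<close> by 1/2, with \<open>a = q powr (1 / 2)\<close>.\<close>

lemma unit_disc_summable_geometric_mult:
  assumes "unit_disc_summable c" "\<bar>a\<bar> \<le> 1"
  shows "unit_disc_summable (\<lambda>n. a ^ n * c n)"
  unfolding unit_disc_summable_def
proof safe
  fix z :: real assume z: "\<bar>z\<bar> < 1"
  have "\<bar>a * z\<bar> \<le> 1 * \<bar>z\<bar>" unfolding abs_mult using assms by (intro mult_right_mono) auto
  then have "\<bar>a * z\<bar> < 1" using z by simp
  with assms have "summable (\<lambda>n. c n * (a * z) ^ n)" unfolding unit_disc_summable_def by blast
  then show "summable (\<lambda>n. a ^ n * c n * z ^ n)" by (simp add: power_mult_distrib mult_ac)
qed

text \<open>This is the Euler operator z d/dz. The extra factor \<open>z\<close> undoes the index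
  shift in \<open>diffs\<close>, so the operator acts on each coefficient separately.\<close>

lemma z_times_diffs_sums:
  fixes c :: "nat \<Rightarrow> real"
  assumes "unit_disc_summable c" "\<bar>z\<bar> < 1"
  shows "(\<lambda>n. real n * c n * z ^ n) sums (z * (\<Sum>n. diffs c n * z ^ n))"
proof -
  have "summable (\<lambda>n. diffs c n * z ^ n)"
    using assms unfolding unit_disc_summable_def
    by (intro termdiff_converges[where K = 1]) auto
  then have "(\<lambda>n. z * (diffs c n * z ^ n)) sums (z * (\<Sum>n. diffs c n * z ^ n))"
    by (intro sums_mult summable_sums)
  then have "(\<lambda>n. real (Suc n) * c (Suc n) * z ^ Suc n) sums (z * (\<Sum>n. diffs c n * z ^ n))"
    by (simp add: diffs_def mult_ac)
  \<comment> \<open>The added term at index 0 vanishes because of its factor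
    \<open>real 0\<close>.\<close>
  then show ?thesis by (subst (asm) sums_Suc_iff) simp
qed

lemma unit_disc_summable_of_nat_mult:
  "unit_disc_summable c \<Longrightarrow> unit_disc_summable (\<lambda>n. real n * c n)"
  using z_times_diffs_sums unfolding unit_disc_summable_def by (meson sums_summable)

lemma unit_disc_summable_deriv_coeffs:
  assumes "unit_disc_summable c"
  shows "unit_disc_summable (\<lambda>n. (real n * a) ^ k * c n)"
proof (induction k)
  case (Suc k)
  from unit_disc_summable_cmult[OF unit_disc_summable_of_nat_mult[OF this], of a]
  show ?case by (simp add: mult_ac)
qed (use assms in simp)

section \<open>Calculus of series in \<open>q powr x\<close>\<close>

context
  fixes q :: real
  assumes q: "0 < q" "q < 1"
begin

lemma q_series_sums:
  assumes "unit_disc_summable c" "x > 0"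
  shows "(\<lambda>n. c n * (q powr x) ^ n) sums q_series q c x"
  using assms q_powr_bounds[OF q] unfolding unit_disc_summable_def q_series_def
  by (intro summable_sums) auto

lemma q_series_add:
  assumes "unit_disc_summable c" "unit_disc_summable d" "x > 0"
  shows "q_series q c x + q_series q d x = q_series q (\<lambda>n. c n + d n) x"
  using sums_add[OF q_series_sums[OF assms(1,3)] q_series_sums[OF assms(2,3)]]
  unfolding q_series_def by (simp add: sums_iff distrib_right)

lemma q_series_cmult:
  assumes "unit_disc_summable c" "x > 0"
  shows "a * q_series q c x = q_series q (\<lambda>n. a * c n) x"
  using sums_mult[OF q_series_sums[OF assms], of a]
  unfolding q_series_def by (simp add: sums_iff mult_ac)

lemma q_series_shift:
  "q_series q c (x + a) = q_series q (\<lambda>n. (q powr a) ^ n * c n) x"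
  unfolding q_series_def by (simp add: powr_add power_mult_distrib mult_ac)

text \<open>By the chain rule d/dx is \<open>ln q\<close> times z d/dz, hence diagonal on
  coefficients.\<close>

lemma q_series_has_field_derivative:
  assumes c: "unit_disc_summable c" and x: "x > 0"
  shows "(q_series q c has_field_derivative q_series q (\<lambda>n. real n * ln q * c n) x) (at x)"
proof -
  define z where "z = q powr x"
  have z: "norm z < 1" using q_powr_bounds[OF q x] by (simp add: z_def)
  have "((\<lambda>z. \<Sum>n. c n * z ^ n) has_field_derivative (\<Sum>n. diffs c n * z ^ n)) (at z)"
    using c z unfolding unit_disc_summable_def by (intro termdiffs_strong'[where K = 1]) auto
  moreover have "((\<lambda>x. q powr x) has_field_derivative ln q * z) (at x)"
    unfolding z_def using q by (auto intro!: derivative_eq_intros)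
  ultimately have "((\<lambda>x. \<Sum>n. c n * (q powr x) ^ n) has_field_derivative
      (\<Sum>n. diffs c n * z ^ n) * (ln q * z)) (at x)"
    unfolding z_def by (rule DERIV_chain2)
  moreover have "(\<lambda>n. ln q * (real n * c n * z ^ n)) sums (ln q * (z * (\<Sum>n. diffs c n * z ^ n)))"
    using z_times_diffs_sums[OF c] z by (intro sums_mult) auto
  then have "(\<Sum>n. diffs c n * z ^ n) * (ln q * z) = q_series q (\<lambda>n. real n * ln q * c n) x"
    unfolding q_series_def z_def by (simp add: sums_iff mult_ac)
  ultimately show ?thesis by (simp add: q_series_def[abs_def])
qed

text \<open>A derivative at \<open>x\<close> depends only on values near \<open>x\<close> and
  \<open>{0<..}\<close> is open, so agreement with the series there passes to every order.
  \<open>transfer\<close> is stated for all \<open>k\<close> to serve both the induction and the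
  second claim.\<close>

lemma q_series_higher_deriv:
  assumes c: "unit_disc_summable c" and f: "\<And>x. x > 0 \<Longrightarrow> f x = q_series q c x" and x: "x > 0"
  shows "(deriv ^^ k) f x = q_series q (\<lambda>n. (real n * ln q) ^ k * c n) x"
    and "((deriv ^^ k) f has_field_derivative
           q_series q (\<lambda>n. (real n * ln q) ^ Suc k * c n) x) (at x)"
proof -
  have transfer: "((deriv ^^ k) f has_field_derivative
        q_series q (\<lambda>n. (real n * ln q) ^ Suc k * c n) x) (at x)"
    if eq: "\<And>x. x > 0 \<Longrightarrow> (deriv ^^ k) f x = q_series q (\<lambda>n. (real n * ln q) ^ k * c n) x"
      and x: "x > 0" for k x
    using has_field_derivative_transform_within_open[OF
        q_series_has_field_derivative[OF unit_disc_summable_deriv_coeffs[OF c, of "ln q" k] x],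
        where S = "{0<..}" and g = "(deriv ^^ k) f"] x eq
    by (simp add: mult_ac)
  have "\<forall>x>0. (deriv ^^ k) f x = q_series q (\<lambda>n. (real n * ln q) ^ k * c n) x"
  proof (induction k)
    case 0
    then show ?case using f by simp
  next
    case (Suc k)
    then show ?case using transfer[of k] by (auto intro: DERIV_imp_deriv)
  qed
  then show "(deriv ^^ k) f x = q_series q (\<lambda>n. (real n * ln q) ^ k * c n) x"
    "((deriv ^^ k) f has_field_derivative
           q_series q (\<lambda>n. (real n * ln q) ^ Suc k * c n) x) (at x)"
    using x transfer[of k] by auto
qed

text \<open>Each differentiation multiplies the coefficients by \<open>real n * ln q\<close>, which
  is at most 0; the sign \<open>(-1) ^ k\<close> compensates exactly.\<close>

lemma q_series_completely_monotonic:
  assumes c: "unit_disc_summable c" and nonneg: "\<And>n. c n \<ge> 0"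
    and f: "\<And>x. x > 0 \<Longrightarrow> f x = q_series q c x"
  shows "completely_monotonic_on {0<..} f"
  unfolding completely_monotonic_on_def
proof safe
  fix k :: nat and x :: real assume x: "x > 0"
  show "(deriv ^^ k) f field_differentiable at x"
    using q_series_higher_deriv(2)[OF c f x] field_differentiable_def by blast
  let ?d = "\<lambda>n. (real n * ln q) ^ k * c n"
  have "(-1) ^ k * (deriv ^^ k) f x = q_series q (\<lambda>n. (-1) ^ k * ?d n) x"
    by (simp add: q_series_higher_deriv(1)[OF c f x]
        q_series_cmult[OF unit_disc_summable_deriv_coeffs[OF c] x])
  also have "(\<lambda>n. (-1) ^ k * ?d n) = (\<lambda>n. (real n * - ln q) ^ k * c n)"
    by (simp add: power_mult_distrib[symmetric] mult.assoc[symmetric])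
  also have "q_series q \<dots> x \<ge> 0"
    unfolding q_series_def
  proof (rule suminf_nonneg)
    show "summable (\<lambda>n. (real n * - ln q) ^ k * c n * (q powr x) ^ n)"
      using unit_disc_summable_deriv_coeffs[OF c, of "- ln q" k] q_powr_bounds[OF q x]
      unfolding unit_disc_summable_def by blast
    show "0 \<le> (real n * - ln q) ^ k * c n * (q powr x) ^ n" for n
      using nonneg[of n] q by (intro mult_nonneg_nonneg zero_le_power) auto
  qed
  finally show "0 \<le> (-1) ^ k * (deriv ^^ k) f x" .
qed

text \<open>
  The junk value \<open>a / 0 = 0\<close> makes the coefficients \<open>1 / n\<close> and \<open>1 / (1 - q ^ n)\<close> vanish for
  \<open>n = 0\<close>, so that all series can start at \<open>0\<close>.
\<close>

lemma unit_disc_summable_inverse_one_minus_power: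
  "unit_disc_summable (\<lambda>n. 1 / (1 - q ^ n))"
proof (rule unit_disc_summable_bounded)
  fix n :: nat
  show "\<bar>1 / (1 - q ^ n)\<bar> \<le> 1 / (1 - q)"
  proof (cases "n = 0")
    case False
    then have "q ^ n \<le> q ^ 1" using q by (intro power_decreasing) auto
    then show ?thesis using q by (auto simp: frac_le)
  qed (use q in simp)
qed

lemma unit_disc_summable_log_qpochhammer: "unit_disc_summable (\<lambda>n. 1 / (real n * (1 - q ^ n)))"
proof (rule unit_disc_summable_bounded)
  fix n :: nat
  show "\<bar>1 / (real n * (1 - q ^ n))\<bar> \<le> 1 / (1 - q)"
  proof (cases "n = 0")
    case False
    then have "q ^ n \<le> q ^ 1" using q by (intro power_decreasing) auto
    then have "1 * (1 - q) \<le> real n * (1 - q ^ n)"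
      using False q by (intro mult_mono) auto
    then show ?thesis using q by (auto simp: frac_le)
  qed (use q in simp)
qed

section \<open>Exponential form of the infinite product\<close>

lemma qpochhammer_inf_eq_exp:
  assumes z: "0 < z" "z < 1"
  shows "qpochhammer_inf z q = exp (- (\<Sum>n. 1 / (real n * (1 - q ^ n)) * z ^ n))"
proof -
  define a where "a = (\<lambda>n. 1 / (real n * (1 - q ^ n)))"
  define s where "s = (\<lambda>z. \<Sum>n. a n * z ^ n)"
  have a: "summable (\<lambda>n. a n * z ^ n)" if "\<bar>z\<bar> < 1" for z
    using unit_disc_summable_log_qpochhammer that
    unfolding unit_disc_summable_def a_def by blast
  \<comment> \<open>Since \<open>a n * (1 - q ^ n) = 1 / n\<close> for positive \<open>n\<close>,
    the difference \<open>s z - s (q * z)\<close> is the series of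
    \<open>- ln (1 - z)\<close>.\<close>
  have step: "exp (- s z) = (1 - z) * exp (- s (q * z))" if z: "0 < z" "z < 1" for z
  proof -
    have "q * z < 1 * 1" using z q by (intro mult_strict_mono) auto
    with z q have "(\<lambda>n. a n * z ^ n - a n * (q * z) ^ n) sums (s z - s (q * z))"
      unfolding s_def by (intro sums_diff summable_sums a) auto
    also have "(\<lambda>n. a n * z ^ n - a n * (q * z) ^ n) = (\<lambda>n. z ^ n / real n)"
    proof
      fix n :: nat
      show "a n * z ^ n - a n * (q * z) ^ n = z ^ n / real n"
      proof (cases "n = 0")
        case False
        then have "q ^ n < 1" using q by (simp add: power_less_one_iff)
        then have "a n * (1 - q ^ n) = 1 / real n" by (simp add: a_def)
        moreover have "a n * z ^ n - a n * (q * z) ^ n = a n * (1 - q ^ n) * z ^ n"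
          by (simp add: power_mult_distrib algebra_simps)
        ultimately show ?thesis by simp
      qed (simp add: a_def)
    qed
    finally have "(\<lambda>n. - (z ^ n / real n)) sums - (s z - s (q * z))" by (rule sums_minus)
    moreover have "(\<lambda>n. - (z ^ n / real n)) sums ln (1 - z)"
      using ln_series'[of "- z"] z by simp
    ultimately have "- (s z - s (q * z)) = ln (1 - z)" by (rule sums_unique2)
    then have "- s z = ln (1 - z) + - s (q * z)" by simp
    then show ?thesis using z by (simp only: exp_add) simp
  qed
  \<comment> \<open>The functional equation at the points \<open>z * q ^ n\<close> makes the partial
    products telescope.\<close>
  have prod: "(\<Prod>n<N. 1 - z * q ^ n) = exp (- s z) / exp (- s (z * q ^ N))" for N
  proof (induction N)
    case (Suc N)
    have "z * q ^ N \<le> z * 1" using z q by (intro mult_left_mono power_le_one) auto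
    then have "z * q ^ N < 1" using z by linarith
    moreover from this have "exp (- s (z * q ^ N)) = (1 - z * q ^ N) * exp (- s (z * q ^ Suc N))"
      using step[of "z * q ^ N"] z q by (simp add: mult_ac)
    moreover have "(\<Prod>n<Suc N. 1 - z * q ^ n) =
        exp (- s z) / exp (- s (z * q ^ N)) * (1 - z * q ^ N)"
      using Suc by simp
    ultimately show ?case by (simp del: power_Suc prod.lessThan_Suc)
  qed simp
  \<comment> \<open>Continuity at 0 and \<open>s 0 = 0\<close> (from \<open>a 0 = 0\<close>) send
    the denominator of the telescoped product to 1. The radius 1/2 is an arbitrary choice inside the
    disc.\<close>
  have "isCont s 0"
    unfolding s_def by (rule isCont_powser[where K = "1/2"]) (use a in auto)
  moreover have "(\<lambda>N. z * q ^ N) \<longlonglongrightarrow> 0"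
    using q by (auto intro!: tendsto_eq_intros LIMSEQ_power_zero)
  ultimately have "(\<lambda>N. s (z * q ^ N)) \<longlonglongrightarrow> s 0" by (rule isCont_tendsto_compose)
  moreover have "s 0 = 0" unfolding s_def powser_zero by (simp add: a_def)
  ultimately have "(\<lambda>N. \<Prod>n<N. 1 - z * q ^ n) \<longlonglongrightarrow> exp (- s z)"
    unfolding prod by (auto intro!: tendsto_eq_intros)
  then have "(\<lambda>N. \<Prod>n\<le>N. 1 - z * q ^ n) \<longlonglongrightarrow> exp (- s z)"
    using LIMSEQ_lessThan_iff_atMost by blast
  \<comment> \<open>\<open>raw_has_prod\<close> also demands a nonzero limit, which an exponential
    provides.\<close>
  then have "raw_has_prod (\<lambda>n. 1 - z * q ^ n) 0 (exp (- s z))"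
    by (simp add: raw_has_prod_def)
  then have "(\<lambda>n. 1 - z * q ^ n) has_prod exp (- s z)"
    by (simp add: has_prod_def)
  then show ?thesis
    unfolding qpochhammer_inf_def s_def a_def by (rule has_prod_unique[symmetric])
qed

section \<open>Series for the digamma, logarithmic and fractional terms\<close>

text \<open>From psi_q(x) = -ln(1-q) + ln q * sum over n >= 1 of q^(nx)/(1-q^n); index 0 carries the
  constant.\<close>

definition q_Digamma_coeff :: "nat \<Rightarrow> real" where
  "q_Digamma_coeff n = (if n = 0 then - ln (1 - q) else ln q / (1 - q ^ n))"

lemma unit_disc_summable_q_Digamma_coeff: "unit_disc_summable q_Digamma_coeff"
proof -
  from unit_disc_summable_add[OF unit_disc_summable_const
      unit_disc_summable_cmult[OF unit_disc_summable_inverse_one_minus_power, of "ln q"]]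
  have "unit_disc_summable
      (\<lambda>n. (if n = 0 then - ln (1 - q) else 0) + ln q * (1 / (1 - q ^ n)))" .
  also have "\<dots> = (\<lambda>n. q_Digamma_coeff n)"
    by (auto simp: q_Digamma_coeff_def)
  finally show ?thesis .
qed

lemma q_series_const_add:
  assumes "unit_disc_summable c" "x > 0"
  shows "a + q_series q c x = q_series q (\<lambda>n. (if n = 0 then a else 0) + c n) x"
proof -
  have "q_series q (\<lambda>n. if n = 0 then a else 0) x = a"
    unfolding q_series_def by (subst suminf_finite[of "{0}"]) auto
  then show ?thesis using q_series_add[OF unit_disc_summable_const assms] by metis
qed

text \<open>On the positive axis \<open>q_Gamma q\<close> is a positive constant times the
  exponential of a q-series plus a linear term, so its logarithmic derivative is the derivative of
  that exponent.\<close>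

lemma q_Digamma_eq_q_series:
  assumes x: "x > 0"
  shows "q_Digamma q x = q_series q q_Digamma_coeff x"
proof -
  define a where "a = (\<lambda>n. 1 / (real n * (1 - q ^ n)))"
  have a: "unit_disc_summable a" unfolding a_def by (rule unit_disc_summable_log_qpochhammer)
  define K where "K = qpochhammer_inf q q"
  have K: "K > 0" unfolding K_def by (subst qpochhammer_inf_eq_exp) (use q in auto)
  have Gamma: "q_Gamma q y = K * exp (q_series q a y + (1 - y) * ln (1 - q))" if "y > 0" for y
  proof -
    have "qpochhammer_inf (q powr y) q = exp (- q_series q a y)"
      using qpochhammer_inf_eq_exp[OF q_powr_bounds(1,2)[OF q that]]
      by (simp only: q_series_def a_def)
    moreover have "(1 - q) powr (1 - y) = exp ((1 - y) * ln (1 - q))" using q by (simp add: powr_def)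
    ultimately show ?thesis unfolding q_Gamma_def K_def by (simp add: exp_add exp_minus divide_inverse)
  qed
  let ?d = "q_series q (\<lambda>n. real n * ln q * a n) x - ln (1 - q)"
  have "((\<lambda>y. K * exp (q_series q a y + (1 - y) * ln (1 - q))) has_field_derivative
      K * exp (q_series q a x + (1 - x) * ln (1 - q)) * ?d) (at x)"
    by (rule derivative_eq_intros q_series_has_field_derivative[OF a x] refl)+ simp
  then have "(q_Gamma q has_field_derivative
      K * exp (q_series q a x + (1 - x) * ln (1 - q)) * ?d) (at x)"
    by (rule has_field_derivative_transform_within_open[where S = "{0<..}"]) (use x Gamma in auto)
  then have "q_Digamma q x = ?d"
    using K Gamma[OF x] unfolding q_Digamma_def by (simp add: DERIV_imp_deriv)
  \<comment> \<open>The exponent 1 gives the coefficients the shape expected by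
    \<open>unit_disc_summable_deriv_coeffs\<close>.\<close>
  also have "\<dots> = - ln (1 - q) + q_series q (\<lambda>n. (real n * ln q) ^ 1 * a n) x" by simp
  also have "\<dots> = q_series q (\<lambda>n. (if n = 0 then - ln (1 - q) else 0) + (real n * ln q) ^ 1 * a n) x"
    by (rule q_series_const_add[OF unit_disc_summable_deriv_coeffs[OF a] x])
  also have "(\<lambda>n. (if n = 0 then - ln (1 - q) else 0) + (real n * ln q) ^ 1 * a n) = q_Digamma_coeff"
    by (auto simp: q_Digamma_coeff_def a_def)
  finally show ?thesis .
qed

lemma ln_one_minus_q_powr_eq_q_series:
  assumes x: "x > 0"
  shows "ln ((1 - q powr x) / (1 - q)) =
    q_series q (\<lambda>n. (if n = 0 then - ln (1 - q) else 0) + (-1) * (1 / real n)) x"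
proof -
  have "(\<lambda>n. - ((q powr x) ^ n / real n)) sums ln (1 - q powr x)"
    using ln_series'[of "- (q powr x)"] q_powr_bounds[OF q x] by simp
  then have "ln (1 - q powr x) = q_series q (\<lambda>n. (-1) * (1 / real n)) x"
    by (simp add: q_series_def sums_iff)
  moreover have "ln ((1 - q powr x) / (1 - q)) = - ln (1 - q) + ln (1 - q powr x)"
    using q_powr_bounds[OF q x] q x by (simp add: ln_div)
  ultimately show ?thesis
    using q_series_const_add[OF unit_disc_summable_cmult[OF unit_disc_summable_inverse_nat] x]
    by metis
qed

lemma q_powr_fraction_eq_q_series:
  assumes x: "x > 0"
  shows "(ln q * q powr x) / (2 * (1 - q powr x)) =
    q_series q (\<lambda>n. if n = 0 then 0 else ln q / 2) x"
proof -
  have "(\<lambda>n. ln q / 2 * q powr x * (q powr x) ^ n) sums (ln q / 2 * q powr x * (1 / (1 - q powr x)))"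
    using q_powr_bounds[OF q x] by (intro sums_mult geometric_sums) auto
  then have "(\<lambda>n. (if Suc n = 0 then 0 else ln q / 2) * (q powr x) ^ Suc n) sums
      (ln q / 2 * q powr x * (1 / (1 - q powr x)))"
    by (simp add: mult_ac)
  then have "(\<lambda>n. (if n = 0 then 0 else ln q / 2) * (q powr x) ^ n) sums
      (ln q / 2 * q powr x * (1 / (1 - q powr x)))"
    by (subst (asm) sums_Suc_iff) simp
  then show ?thesis by (simp add: q_series_def sums_iff)
qed

end

section \<open>Two exponential inequalities\<close>

lemma nonneg_from_derivative:
  fixes f f' :: "real \<Rightarrow> real"
  assumes "\<And>t. t \<ge> 0 \<Longrightarrow> (f has_real_derivative f' t) (at t)"
    and "\<And>t. t \<ge> 0 \<Longrightarrow> f' t \<ge> 0" and "f 0 = 0" "u \<ge> 0"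
  shows "f u \<ge> 0"
  using DERIV_nonneg_imp_nondecreasing[of 0 u f] assms by force

text \<open>Twice the inequality u^3/3 <= u cosh u - sinh u. Differentiating leaves \<open>t\<close>
  times a factor that vanishes at 0 and has derivative 2 cosh s - 2.\<close>

lemma exp_lower_bound_half_shift:
  fixes u :: real
  assumes "u \<ge> 0"
  shows "(u - 1) * exp u + (u + 1) * exp (- u) - 2 / 3 * u ^ 3 \<ge> 0"
proof (rule nonneg_from_derivative[OF _ _ _ assms])
  fix t :: real assume t: "t \<ge> 0"
  show "((\<lambda>u. (u - 1) * exp u + (u + 1) * exp (- u) - 2 / 3 * u ^ 3) has_real_derivative
      t * (exp t - exp (- t) - 2 * t)) (at t)"
    by (auto intro!: derivative_eq_intros simp: algebra_simps power2_eq_square)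
  have "exp t - exp (- t) - 2 * t \<ge> 0"
  proof (rule nonneg_from_derivative[OF _ _ _ t])
    fix s :: real
    show "((\<lambda>t. exp t - exp (- t) - 2 * t) has_real_derivative exp s + exp (- s) - 2) (at s)"
      by (auto intro!: derivative_eq_intros)
    show "exp s + exp (- s) - 2 \<ge> 0"
      using exp_ge_add_one_self[of s] exp_ge_add_one_self[of "- s"] by linarith
  qed simp
  then show "t * (exp t - exp (- t) - 2 * t) \<ge> 0" using t by simp
qed simp

text \<open>The inequality u cosh u - sinh u <= e^u u^3/3 multiplied by 2 e^(-u). Two
  differentiations give an expression of evident sign.\<close>

lemma exp_lower_bound_unshifted:
  fixes u :: real
  assumes "u \<ge> 0"
  shows "(1 - u) - (1 + u) * exp (- 2 * u) + 2 / 3 * u ^ 3 \<ge> 0"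
proof (rule nonneg_from_derivative[OF _ _ _ assms])
  fix t :: real assume t: "t \<ge> 0"
  show "((\<lambda>u. (1 - u) - (1 + u) * exp (- 2 * u) + 2 / 3 * u ^ 3) has_real_derivative
      (1 + 2 * t) * exp (- 2 * t) + 2 * t ^ 2 - 1) (at t)"
    by (auto intro!: derivative_eq_intros simp: algebra_simps)
  show "(1 + 2 * t) * exp (- 2 * t) + 2 * t ^ 2 - 1 \<ge> 0"
  proof (rule nonneg_from_derivative[OF _ _ _ t])
    fix s :: real assume s: "s \<ge> 0"
    show "((\<lambda>t. (1 + 2 * t) * exp (- 2 * t) + 2 * t ^ 2 - 1) has_real_derivative
        4 * s * (1 - exp (- 2 * s))) (at s)"
      by (auto intro!: derivative_eq_intros simp: algebra_simps)
    show "4 * s * (1 - exp (- 2 * s)) \<ge> 0" using s by simp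
  qed simp
qed simp

section \<open>Nonnegativity of the coefficients\<close>

context
  fixes q u E :: real and n :: nat
  assumes q: "0 < q" "q < 1" and n: "n > 0"
  defines "u \<equiv> - (real n * ln q) / 2" and "E \<equiv> exp (- u)"
begin

text \<open>Halving the exponent gives E = q^(n/2), so \<open>q ^ n\<close> and the factor from the
  half shift are both powers of \<open>E\<close>, and the coefficients become rational in
  \<open>u\<close>, \<open>E\<close> and \<open>n\<close>.\<close>

lemma power_eq_exp_half:
  "u > 0" "0 < E" "E < 1" "q ^ n = E ^ 2" "(q powr (1 / 2)) ^ n = E" "ln q = - 2 * u / real n"
proof -
  show "u > 0" using q n by (simp add: u_def mult_pos_neg)
  then show "0 < E" "E < 1" by (auto simp: E_def)
  show "q ^ n = E ^ 2"
    using q by (simp add: E_def u_def exp_of_nat_mult exp_double[symmetric])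
  show "(q powr (1 / 2)) ^ n = E"
    using q by (simp add: E_def u_def powr_def exp_of_nat_mult[symmetric])
  show "ln q = - 2 * u / real n" using n by (simp add: u_def)
qed

lemma half_shift_coeff_nonneg:
  "- (ln q / (1 - q ^ n)) - 1 / real n + ln q / 2 +
     1 / 12 * ((q powr (1 / 2)) ^ n * ((real n * ln q) ^ 2 * (ln q / (1 - q ^ n)))) \<ge> 0"
proof -
  note u = power_eq_exp_half
  have E2: "E ^ 2 < 1" using u(2,3) by (simp add: power_less_one_iff)
  have nq: "real n * ln q = - 2 * u" and lnq: "ln q = - 2 * u / real n" using u(6) n by auto
  \<comment> \<open>The factor \<open>E = exp (- u)\<close> removes \<open>exp u\<close>; dividing
    by \<open>real n * (1 - E ^ 2)\<close>, the common denominator, then yields the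
    coefficient.\<close>
  have "0 \<le> E * ((u - 1) * exp u + (u + 1) * exp (- u) - 2 / 3 * u ^ 3)"
    using exp_lower_bound_half_shift[of u] u(1,2) by simp
  also have "\<dots> = (u - 1) * (E * exp u) + (u + 1) * E ^ 2 - 2 / 3 * u ^ 3 * E"
    by (simp add: E_def power2_eq_square algebra_simps)
  also have "E * exp u = 1" by (simp add: E_def exp_minus)
  finally have "0 \<le> ((u - 1) * 1 + (u + 1) * E ^ 2 - 2 / 3 * u ^ 3 * E) / (real n * (1 - E ^ 2))"
    using E2 n by (intro divide_nonneg_nonneg) auto
  also have "\<dots> = - (ln q / (1 - q ^ n)) - 1 / real n + ln q / 2 +
     1 / 12 * ((q powr (1 / 2)) ^ n * ((real n * ln q) ^ 2 * (ln q / (1 - q ^ n))))"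
    using n E2 unfolding u(4,5) nq lnq
    by (simp add: divide_simps) (simp add: algebra_simps power2_eq_square power3_eq_cube)
  finally show ?thesis .
qed

lemma unshifted_coeff_nonneg:
  "ln q / (1 - q ^ n) + 1 / real n - ln q / 2 -
     1 / 12 * ((real n * ln q) ^ 2 * (ln q / (1 - q ^ n))) \<ge> 0"
proof -
  note u = power_eq_exp_half
  have E2: "E ^ 2 < 1" using u(2,3) by (simp add: power_less_one_iff)
  have nq: "real n * ln q = - 2 * u" and lnq: "ln q = - 2 * u / real n" using u(6) n by auto
  \<comment> \<open>No half shift occurs here: the bound is already polynomial in \<open>u\<close>
    and \<open>E ^ 2\<close>, with the same common denominator.\<close>
  have "exp (- 2 * u) = E ^ 2" by (simp add: E_def exp_double[symmetric])
  then have "0 \<le> (1 - u) - (1 + u) * E ^ 2 + 2 / 3 * u ^ 3"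
    using exp_lower_bound_unshifted[of u] u(1) by simp
  then have "0 \<le> ((1 - u) - (1 + u) * E ^ 2 + 2 / 3 * u ^ 3) / (real n * (1 - E ^ 2))"
    using E2 n by (intro divide_nonneg_nonneg) auto
  also have "\<dots> = ln q / (1 - q ^ n) + 1 / real n - ln q / 2 -
     1 / 12 * ((real n * ln q) ^ 2 * (ln q / (1 - q ^ n)))"
    using n E2 unfolding u(4) nq lnq
    by (simp add: divide_simps) (simp add: algebra_simps power2_eq_square power3_eq_cube)
  finally show ?thesis .
qed

end

section \<open>Assembly of both functions from their coefficients\<close>

theorem theorem3p5:
  fixes q :: real
  assumes "0 < q" and "q < 1"
  shows "completely_monotonic_on {0<..}
           (\<lambda>x. - q_Digamma q x + ln ((1 - q powr x) / (1 - q))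
                + (ln q * q powr x) / (2 * (1 - q powr x))
                + 1 / 12 * (deriv ^^ 2) (q_Digamma q) (x + 1 / 2))
       \<and> completely_monotonic_on {0<..}
           (\<lambda>x. q_Digamma q x - ln ((1 - q powr x) / (1 - q))
                - (ln q * q powr x) / (2 * (1 - q powr x))
                - 1 / 12 * (deriv ^^ 2) (q_Digamma q) x)"
proof
  note q = assms
  \<comment> \<open>Coefficients of psi_q (\<open>c\<close>), the logarithm (\<open>l\<close>), the
    fraction (\<open>r\<close>), psi_q'' (\<open>d\<close>) and psi_q'' shifted by 1/2
    (\<open>e\<close>).\<close>
  define c where "c = q_Digamma_coeff q"
  define l where "l = (\<lambda>n::nat. (if n = 0 then - ln (1 - q) else 0) + (-1) * (1 / real n))"
  define r where "r = (\<lambda>n::nat. if n = 0 then 0 else ln q / 2)"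
  define d where "d = (\<lambda>n. (real n * ln q) ^ 2 * c n)"
  define e where "e = (\<lambda>n. (q powr (1 / 2)) ^ n * d n)"
  have l: "unit_disc_summable l"
    unfolding l_def
    by (intro unit_disc_summable_add unit_disc_summable_const unit_disc_summable_cmult
        unit_disc_summable_inverse_nat)
  have r: "unit_disc_summable r"
    unfolding r_def by (rule unit_disc_summable_bounded[where B = "\<bar>ln q / 2\<bar>"]) auto
  have c: "unit_disc_summable c"
    unfolding c_def by (rule unit_disc_summable_q_Digamma_coeff[OF q])
  have d: "unit_disc_summable d"
    unfolding d_def by (rule unit_disc_summable_deriv_coeffs[OF c])
  have e: "unit_disc_summable e"
    unfolding e_def using q_powr_bounds[OF q, of "1 / 2"]
    by (intro unit_disc_summable_geometric_mult d) simp
  note summable = unit_disc_summable_add unit_disc_summable_cmult c l r d e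
  have psi: "q_Digamma q x = q_series q c x" if "x > 0" for x
    unfolding c_def by (rule q_Digamma_eq_q_series[OF q that])
  have psi'': "(deriv ^^ 2) (q_Digamma q) x = q_series q d x" if "x > 0" for x
    unfolding d_def by (rule q_series_higher_deriv(1)[OF q c psi that])
  have psi''_half: "(deriv ^^ 2) (q_Digamma q) (x + 1 / 2) = q_series q e x" if "x > 0" for x
    unfolding e_def by (subst psi'') (use that q_series_shift[OF q] in auto)
  have log: "ln ((1 - q powr x) / (1 - q)) = q_series q l x" if "x > 0" for x
    unfolding l_def by (rule ln_one_minus_q_powr_eq_q_series[OF q that])
  have frac: "(ln q * q powr x) / (2 * (1 - q powr x)) = q_series q r x" if "x > 0" for x
    unfolding r_def by (rule q_powr_fraction_eq_q_series[OF q that])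
  show "completely_monotonic_on {0<..}
           (\<lambda>x. - q_Digamma q x + ln ((1 - q powr x) / (1 - q))
                + (ln q * q powr x) / (2 * (1 - q powr x))
                + 1 / 12 * (deriv ^^ 2) (q_Digamma q) (x + 1 / 2))"
  proof (rule q_series_completely_monotonic[OF q])
    show "unit_disc_summable (\<lambda>n. (-1) * c n + l n + r n + 1 / 12 * e n)"
      by (intro summable)
    \<comment> \<open>At index 0 the constants cancel: \<open>c 0\<close> and \<open>l 0\<close>
      both equal \<open>- ln (1 - q)\<close>, while \<open>r 0\<close> and \<open>e 0\<close> are
      0.\<close>
    show "0 \<le> (-1) * c n + l n + r n + 1 / 12 * e n" for n
      using half_shift_coeff_nonneg[OF q, of n]
      by (cases "n = 0") (auto simp: c_def l_def r_def d_def e_def q_Digamma_coeff_def[OF q])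
    show "- q_Digamma q x + ln ((1 - q powr x) / (1 - q))
                + (ln q * q powr x) / (2 * (1 - q powr x))
                + 1 / 12 * (deriv ^^ 2) (q_Digamma q) (x + 1 / 2)
        = q_series q (\<lambda>n. (-1) * c n + l n + r n + 1 / 12 * e n) x" if x: "x > 0" for x
    proof -
      have "(-1) * q_series q c x + q_series q l x + q_series q r x + 1 / 12 * q_series q e x
        = q_series q (\<lambda>n. (-1) * c n + l n + r n + 1 / 12 * e n) x"
        unfolding q_series_cmult[OF q c x] q_series_cmult[OF q e x]
        by (simp only: q_series_add[OF q _ _ x] summable)
      then show ?thesis using psi[OF x] log[OF x] frac[OF x] psi''_half[OF x] by simp
    qed
  qed
  show "completely_monotonic_on {0<..}
           (\<lambda>x. q_Digamma q x - ln ((1 - q powr x) / (1 - q))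
                - (ln q * q powr x) / (2 * (1 - q powr x))
                - 1 / 12 * (deriv ^^ 2) (q_Digamma q) x)"
  proof (rule q_series_completely_monotonic[OF q])
    show "unit_disc_summable (\<lambda>n. c n + (-1) * l n + (-1) * r n + (- 1 / 12) * d n)"
      by (intro summable)
    \<comment> \<open>The same cancellation at index 0, with \<open>d 0 = 0\<close> in place of
      \<open>e 0 = 0\<close>.\<close>
    show "0 \<le> c n + (-1) * l n + (-1) * r n + (- 1 / 12) * d n" for n
      using unshifted_coeff_nonneg[OF q, of n]
      by (cases "n = 0") (auto simp: c_def l_def r_def d_def q_Digamma_coeff_def[OF q])
    show "q_Digamma q x - ln ((1 - q powr x) / (1 - q))
                - (ln q * q powr x) / (2 * (1 - q powr x))
                - 1 / 12 * (deriv ^^ 2) (q_Digamma q) x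
        = q_series q (\<lambda>n. c n + (-1) * l n + (-1) * r n + (- 1 / 12) * d n) x" if x: "x > 0" for x
    proof -
      \<comment> \<open>Differences are written as sums with scalar factors so that only
        \<open>q_series_cmult\<close> and \<open>q_series_add\<close> are needed.\<close>
      have "q_series q c x + (-1) * q_series q l x + (-1) * q_series q r x
          + (- 1 / 12) * q_series q d x
        = q_series q (\<lambda>n. c n + (-1) * l n + (-1) * r n + (- 1 / 12) * d n) x"
        unfolding q_series_cmult[OF q l x] q_series_cmult[OF q r x] q_series_cmult[OF q d x]
        by (simp only: q_series_add[OF q _ _ x] summable)
      then show ?thesis using psi[OF x] log[OF x] frac[OF x] psi''[OF x] by simp
    qed
  qed
qed

end
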